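(* Let $G$ be an exponential Lie group and let $H\subset G$ be a closed subgroup having the complemented commutator property with respect to a continuous section $\mathsf{s}:X=G/H\to G$. Let $\chi$ be a unitary character of $H$ and let $\rho_\chi$ be an irreducible square integrable unitary representation of $G$ in a Hilbert space $V$, induced from the character $\chi$ of $H$. Let $\phi\in V$ be a (suitably normalised) admissible vector, put $\Phi=\mathcal{W}_\phi\phi$, and let $f$ be a function on $X$ such that $\Phi$ does not vanish on $\mathsf{s}(X)$ and $f\Phi^{-1}\in L_1(X)$. Then $$\|\rho_\chi(f)\|\le \bigl\|(f\Phi^{-1})^{\frown}\bigr\|_\infty ,$$ where the left-hand side is the operator norm on $V$ and the right-hand side is the sup-norm over $G$ of the function $$(f\Phi^{-1})^{\frown}(g)=\int_X f(x)\,\Phi(\mathsf{s}(x))^{-1}\,\chi\bigl(g^{-1}\mathsf{s}(x)^{-1}g\,\mathsf{s}(x)\bigr)\,dx,\qquad g\in G.$$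
   Context: Let $\mathsf{p}:G\to X=G/H$ be the natural projection; a section $\mathsf{s}:X\to G$ is a right inverse of $\mathsf{p}$; $dx$ is an invariant measure on $X$. Complemented commutator property: $H$ has this property if there is a continuous section $\mathsf{s}:X\to G$ with $\mathsf{p}(\mathsf{s}(x)^{-1}g\,\mathsf{s}(x))=\mathsf{p}(g)$ for all $x\in X$, $g\in G$. In that case $g^{-1}\mathsf{s}(x)^{-1}g\,\mathsf{s}(x)\in H$ for all $x\in X$, $g\in G$. For $k\in L_1(X)$ define the function $k^{\frown}$ on $G$ by $k^{\frown}(g)=\int_X k(x)\,\chi(g^{-1}\mathsf{s}(x)^{-1}g\,\mathsf{s}(x))\,dx$. Relative convolution: for a representation $\rho$ of $G$ in $V$ and a function $k$ on $X$, $\rho(k)=\int_X k(x)\,\rho(\mathsf{s}(x))\,dx$ (weak operator integral). Covariant (wavelet) transform: for $\phi\in V$, $[\mathcal{W}_\phi v](g)=\langle v,\rho(g)\phi\rangle$, $g\in G$. So $\Phi(g)=\langle\phi,\rho(g)\phi\rangle$; on $X$ the function $\Phi$ is understood as $x\mapsto\Phi(\mathsf{s}(x))$. Contravariant transform: $\mathcal{M}_\phi(F)=\int_X F(\mathsf{s}(x))\,\rho(\mathsf{s}(x))\phi\,dx$. Conventions for the induced representation $\rho=\rho_\chi$ and the admissible vector $\phi$: (i) $\mathcal{W}_\phi$ maps $V$ into the space $L_2^\chi(G)$ of functions $F$ on $G$ with $F(gh)=\chi(h)F(g)$ for $g\in G$, $h\in H$, and finite norm $\left(\int_X|F(\mathsf{s}(x))|^2dx\right)^{1/2}$;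 (ii) square integrability and the normalisation of $\phi$ mean that $\|\phi\|=1$ and, for all $g\in G$, $\mathcal{M}_\phi\circ\mathcal{W}_{\rho(g)\phi}=\langle\phi,\rho(g)\phi\rangle I$ on $V$, with $\mathcal{W}_\phi$ an isometry into $L_2^\chi(G)$ and $\mathcal{M}_\phi$ a partial isometry (norm at most $1$) from $L_2^\chi(G)$ to $V$. *)

theory Defs
  imports "HOL-Analysis.Analysis" "HOL-Algebra.Left_Coset"
begin

subsection \<open>Exponential Lie groups\<close>

text \<open>
  Manifolds are modelled on a linear subspace \<open>E\<close> of a Euclidean space, so that their dimension
  \<open>dim E\<close> may be any natural number, 0 included (no type of class \<open>euclidean_space\<close> has
  dimension 0). The set \<open>S\<close> below is meant to be open in \<open>E\<close>, and only directional derivatives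
  along \<open>E\<close> are iterated; these are uniquely determined by the values of \<open>f\<close> on \<open>S\<close>.
\<close>

primrec Ck_on ::
  "nat \<Rightarrow> 'e set \<Rightarrow> 'e set \<Rightarrow> ('e::real_normed_vector \<Rightarrow> 'f::real_normed_vector) \<Rightarrow> bool"
where
  "Ck_on 0 E S f = continuous_on S f"
| "Ck_on (Suc k) E S f =
    (\<exists>f'. (\<forall>x\<in>S. (f has_derivative f' x) (at x within S)) \<and>
          (\<forall>v\<in>E. Ck_on k E S (\<lambda>x. f' x v)))"

definition smooth_on ::
  "'e set \<Rightarrow> 'e set \<Rightarrow> ('e::real_normed_vector \<Rightarrow> 'f::real_normed_vector) \<Rightarrow> bool"
where "smooth_on E S f \<longleftrightarrow> (\<forall>k. Ck_on k E S f)"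

type_synonym ('a, 'e) chart = "'a set \<times> ('a \<Rightarrow> 'e)"

definition smooth_atlas ::
  "'a topology \<Rightarrow> 'e::euclidean_space set \<Rightarrow> ('a, 'e) chart set \<Rightarrow> bool"
where
  "smooth_atlas T E A \<longleftrightarrow>
     subspace E \<and>
     (\<forall>(U, c)\<in>A. openin T U \<and> openin (top_of_set E) (c ` U) \<and>
        homeomorphic_map (subtopology T U) (top_of_set (c ` U)) c) \<and>
     (\<Union>(U, c)\<in>A. U) = topspace T \<and>
     (\<forall>(U, c)\<in>A. \<forall>(V, d)\<in>A. smooth_on E (c ` (U \<inter> V)) (\<lambda>y. d (inv_into U c y)))"

definition smooth_manifold ::
  "'a topology \<Rightarrow> 'e::euclidean_space set \<Rightarrow> ('a, 'e) chart set \<Rightarrow> bool"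
where
  "smooth_manifold T E A \<longleftrightarrow> Hausdorff_space T \<and> second_countable T \<and> smooth_atlas T E A"

definition smooth_map ::
  "'a topology \<Rightarrow> 'd::euclidean_space set \<Rightarrow> ('a, 'd) chart set \<Rightarrow>
   'b topology \<Rightarrow> 'e::euclidean_space set \<Rightarrow> ('b, 'e) chart set \<Rightarrow> ('a \<Rightarrow> 'b) \<Rightarrow> bool"
where
  "smooth_map T D A T' E B f \<longleftrightarrow>
     continuous_map T T' f \<and>
     (\<forall>(U, c)\<in>A. \<forall>(V, d)\<in>B. smooth_on D (c ` (U \<inter> f -` V)) (\<lambda>y. d (f (inv_into U c y))))"

definition prod_atlas ::
  "('a, 'd) chart set \<Rightarrow> ('b, 'e) chart set \<Rightarrow> ('a \<times> 'b, 'd \<times> 'e) chart set"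
where "prod_atlas A B = {(U \<times> V, map_prod c d) | U c V d. (U, c) \<in> A \<and> (V, d) \<in> B}"

definition lie_group ::
  "('g, 'm) monoid_scheme \<Rightarrow> 'g topology \<Rightarrow> 'e::euclidean_space set \<Rightarrow> ('g, 'e) chart set \<Rightarrow> bool"
where
  "lie_group G T E A \<longleftrightarrow>
     group G \<and> topspace T = carrier G \<and> smooth_manifold T E A \<and>
     smooth_map (prod_topology T T) (E \<times> E) (prod_atlas A A) T E A (\<lambda>(g, h). g \<otimes>\<^bsub>G\<^esub> h) \<and>
     smooth_map T E A T E A (\<lambda>g. inv\<^bsub>G\<^esub> g)"

definition one_parameter_subgroup ::
  "('g, 'm) monoid_scheme \<Rightarrow> 'g topology \<Rightarrow> 'e::euclidean_space set \<Rightarrow> ('g, 'e) chart set \<Rightarrow>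
   (real \<Rightarrow> 'g) \<Rightarrow> bool"
where
  "one_parameter_subgroup G T E A \<gamma> \<longleftrightarrow>
     smooth_map euclideanreal UNIV {(UNIV, \<lambda>t. t)} T E A \<gamma> \<and>
     (\<forall>t u. \<gamma> (t + u) = \<gamma> t \<otimes>\<^bsub>G\<^esub> \<gamma> u)"

text \<open>
  The Lie algebra (tangent space at the identity) is identified with \<open>E\<close> through a chart \<open>c\<close>
  around the identity; \<open>lie_exp\<close> sends a tangent vector \<open>v\<close> to the value at time 1 of the
  one-parameter subgroup with initial velocity \<open>v\<close>. Changing the chart changes \<open>lie_exp\<close> by a
  linear automorphism of \<open>E\<close>, so the next definition does not depend on the chart.
\<close>

definition lie_exp ::
  "('g, 'm) monoid_scheme \<Rightarrow> 'g topology \<Rightarrow> 'e::euclidean_space set \<Rightarrow> ('g, 'e) chart set \<Rightarrow>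
   ('g \<Rightarrow> 'e) \<Rightarrow> 'e \<Rightarrow> 'g"
where
  "lie_exp G T E A c v =
     (THE \<gamma>. one_parameter_subgroup G T E A \<gamma> \<and>
        ((\<lambda>t. c (\<gamma> t)) has_vector_derivative v) (at 0)) 1"

definition exponential_lie_group ::
  "('g, 'm) monoid_scheme \<Rightarrow> 'g topology \<Rightarrow> 'e::euclidean_space set \<Rightarrow> ('g, 'e) chart set \<Rightarrow> bool"
where
  "exponential_lie_group G T E A \<longleftrightarrow>
     lie_group G T E A \<and>
     (\<exists>(U, c)\<in>A. \<one>\<^bsub>G\<^esub> \<in> U \<and>
        bij_betw (lie_exp G T E A c) E (carrier G) \<and>
        smooth_map (top_of_set E) E {(E, \<lambda>v. v)} T E A (lie_exp G T E A c) \<and>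
        smooth_map T E A (top_of_set E) E {(E, \<lambda>v. v)} (inv_into E (lie_exp G T E A c)))"


subsection \<open>The homogeneous space \<open>G/H\<close>\<close>

definition coset_topology :: "('g, 'm) monoid_scheme \<Rightarrow> 'g topology \<Rightarrow> 'g set \<Rightarrow> 'g set topology"
where
  "coset_topology G T H =
     topology (\<lambda>\<U>. \<U> \<subseteq> lcosets\<^bsub>G\<^esub> H \<and> openin T {g \<in> topspace T. g <#\<^bsub>G\<^esub> H \<in> \<U>})"

lemma openin_coset_topology:
  "openin (coset_topology G T H) \<U> \<longleftrightarrow>
     \<U> \<subseteq> lcosets\<^bsub>G\<^esub> H \<and> openin T {g \<in> topspace T. g <#\<^bsub>G\<^esub> H \<in> \<U>}"
proof -
  have "istopology (\<lambda>\<U>. \<U> \<subseteq> lcosets\<^bsub>G\<^esub> H \<and> openin T {g \<in> topspace T. g <#\<^bsub>G\<^esub> H \<in> \<U>})"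
    unfolding istopology_def
  proof (rule conjI; intro allI impI conjI)
    fix S R :: "'a set set"
    assume S: "S \<subseteq> lcosets\<^bsub>G\<^esub> H \<and> openin T {g \<in> topspace T. g <#\<^bsub>G\<^esub> H \<in> S}"
      and R: "R \<subseteq> lcosets\<^bsub>G\<^esub> H \<and> openin T {g \<in> topspace T. g <#\<^bsub>G\<^esub> H \<in> R}"
    show "S \<inter> R \<subseteq> lcosets\<^bsub>G\<^esub> H" using S by blast
    have "{g \<in> topspace T. g <#\<^bsub>G\<^esub> H \<in> S \<inter> R} =
        {g \<in> topspace T. g <#\<^bsub>G\<^esub> H \<in> S} \<inter> {g \<in> topspace T. g <#\<^bsub>G\<^esub> H \<in> R}" by blast
    then show "openin T {g \<in> topspace T. g <#\<^bsub>G\<^esub> H \<in> S \<inter> R}" using S R by auto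
  next
    fix \<K> :: "'a set set set"
    assume K: "\<forall>S\<in>\<K>. S \<subseteq> lcosets\<^bsub>G\<^esub> H \<and> openin T {g \<in> topspace T. g <#\<^bsub>G\<^esub> H \<in> S}"
    show "\<Union>\<K> \<subseteq> lcosets\<^bsub>G\<^esub> H" using K by blast
    have "{g \<in> topspace T. g <#\<^bsub>G\<^esub> H \<in> \<Union>\<K>} =
        (\<Union>S\<in>\<K>. {g \<in> topspace T. g <#\<^bsub>G\<^esub> H \<in> S})" by blast
    then show "openin T {g \<in> topspace T. g <#\<^bsub>G\<^esub> H \<in> \<Union>\<K>}" using K by auto
  qed
  then show ?thesis by (simp add: coset_topology_def topology_inverse')
qed

definition continuous_section ::
  "('g, 'm) monoid_scheme \<Rightarrow> 'g topology \<Rightarrow> 'g set \<Rightarrow> ('g set \<Rightarrow> 'g) \<Rightarrow> bool"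
where
  "continuous_section G T H s \<longleftrightarrow>
     continuous_map (coset_topology G T H) T s \<and> (\<forall>x\<in>lcosets\<^bsub>G\<^esub> H. s x <#\<^bsub>G\<^esub> H = x)"

definition complemented_commutator ::
  "('g, 'm) monoid_scheme \<Rightarrow> 'g topology \<Rightarrow> 'g set \<Rightarrow> ('g set \<Rightarrow> 'g) \<Rightarrow> bool"
where
  "complemented_commutator G T H s \<longleftrightarrow>
     continuous_section G T H s \<and>
     (\<forall>x\<in>lcosets\<^bsub>G\<^esub> H. \<forall>g\<in>carrier G.
        (inv\<^bsub>G\<^esub> (s x) \<otimes>\<^bsub>G\<^esub> g \<otimes>\<^bsub>G\<^esub> s x) <#\<^bsub>G\<^esub> H = g <#\<^bsub>G\<^esub> H)"

text \<open>
  A nonzero Borel measure on \<open>G/H\<close>, finite on compact sets and invariant under left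
  translations. Since \<open>G/H\<close> is locally compact, Hausdorff and second countable when \<open>H\<close> is closed,
  such a measure is automatically regular.
\<close>

definition invariant_measure ::
  "('g, 'm) monoid_scheme \<Rightarrow> 'g topology \<Rightarrow> 'g set \<Rightarrow> 'g set measure \<Rightarrow> bool"
where
  "invariant_measure G T H \<mu> \<longleftrightarrow>
     sets \<mu> = sets (sigma (lcosets\<^bsub>G\<^esub> H) {\<U>. openin (coset_topology G T H) \<U>}) \<and>
     emeasure \<mu> (space \<mu>) \<noteq> 0 \<and>
     (\<forall>K. compactin (coset_topology G T H) K \<longrightarrow> emeasure \<mu> K < \<infinity>) \<and>
     (\<forall>g\<in>carrier G. \<forall>B\<in>sets \<mu>. emeasure \<mu> ((\<lambda>x. g <#\<^bsub>G\<^esub> x) ` B) = emeasure \<mu> B)"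

definition unitary_character ::
  "('g, 'm) monoid_scheme \<Rightarrow> 'g topology \<Rightarrow> 'g set \<Rightarrow> ('g \<Rightarrow> complex) \<Rightarrow> bool"
where
  "unitary_character G T H chi \<longleftrightarrow>
     continuous_map (subtopology T H) euclidean chi \<and>
     (\<forall>h\<in>H. norm (chi h) = 1) \<and>
     (\<forall>h\<in>H. \<forall>k\<in>H. chi (h \<otimes>\<^bsub>G\<^esub> k) = chi h * chi k)"


subsection \<open>Complex Hilbert spaces, weak integrals and unitary representations\<close>

text \<open>The inner product is linear in its first argument.\<close>

class complex_hilbert = banach +
  fixes scaleC :: "complex \<Rightarrow> 'a \<Rightarrow> 'a" (infixr "*\<^sub>C" 75)
    and cinner :: "'a \<Rightarrow> 'a \<Rightarrow> complex"
  assumes scaleC_add_right: "a *\<^sub>C (x + y) = a *\<^sub>C x + a *\<^sub>C y"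
    and scaleC_add_left: "(a + b) *\<^sub>C x = a *\<^sub>C x + b *\<^sub>C x"
    and scaleC_scaleC: "a *\<^sub>C (b *\<^sub>C x) = (a * b) *\<^sub>C x"
    and scaleC_of_real: "complex_of_real r *\<^sub>C x = r *\<^sub>R x"
    and cinner_add_left: "cinner (x + y) z = cinner x z + cinner y z"
    and cinner_scaleC_left: "cinner (a *\<^sub>C x) y = a * cinner x y"
    and cinner_commute: "cinner x y = cnj (cinner y x)"
    and cinner_norm: "cinner x x = complex_of_real ((norm x)\<^sup>2)"

definition csubspace :: "'v::complex_hilbert set \<Rightarrow> bool"
where
  "csubspace W \<longleftrightarrow> 0 \<in> W \<and> (\<forall>x\<in>W. \<forall>y\<in>W. x + y \<in> W) \<and> (\<forall>a. \<forall>x\<in>W. a *\<^sub>C x \<in> W)"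

definition has_weak_integral ::
  "'x measure \<Rightarrow> ('x \<Rightarrow> 'v::complex_hilbert) \<Rightarrow> 'v \<Rightarrow> bool"
where
  "has_weak_integral \<mu> F u \<longleftrightarrow>
     (\<forall>w. integrable \<mu> (\<lambda>x. cinner (F x) w) \<and> (LINT x|\<mu>. cinner (F x) w) = cinner u w)"

definition weak_integral :: "'x measure \<Rightarrow> ('x \<Rightarrow> 'v::complex_hilbert) \<Rightarrow> 'v"
where "weak_integral \<mu> F = (THE u. has_weak_integral \<mu> F u)"

definition unitary_operator :: "('v::complex_hilbert \<Rightarrow> 'v) \<Rightarrow> bool"
where
  "unitary_operator U \<longleftrightarrow>
     (\<forall>x y. U (x + y) = U x + U y) \<and> (\<forall>a x. U (a *\<^sub>C x) = a *\<^sub>C U x) \<and>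
     (\<forall>x y. cinner (U x) (U y) = cinner x y) \<and> surj U"

definition unitary_representation ::
  "('g, 'm) monoid_scheme \<Rightarrow> 'g topology \<Rightarrow> ('g \<Rightarrow> 'v::complex_hilbert \<Rightarrow> 'v) \<Rightarrow> bool"
where
  "unitary_representation G T \<rho> \<longleftrightarrow>
     (\<forall>g\<in>carrier G. unitary_operator (\<rho> g)) \<and>
     (\<forall>g\<in>carrier G. \<forall>h\<in>carrier G. \<forall>v. \<rho> (g \<otimes>\<^bsub>G\<^esub> h) v = \<rho> g (\<rho> h v)) \<and>
     (\<forall>v. continuous_map T euclidean (\<lambda>g. \<rho> g v))"

definition irreducible_representation ::
  "('g, 'm) monoid_scheme \<Rightarrow> ('g \<Rightarrow> 'v::complex_hilbert \<Rightarrow> 'v) \<Rightarrow> bool"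
where
  "irreducible_representation G \<rho> \<longleftrightarrow>
     (\<exists>v::'v. v \<noteq> 0) \<and>
     (\<forall>W. csubspace W \<and> closed W \<and> (\<forall>g\<in>carrier G. \<rho> g ` W \<subseteq> W) \<longrightarrow> W = {0} \<or> W = UNIV)"


subsection \<open>Induced representations and admissible vectors\<close>

definition L2chi ::
  "('g, 'm) monoid_scheme \<Rightarrow> 'g set \<Rightarrow> ('g set \<Rightarrow> 'g) \<Rightarrow> 'g set measure \<Rightarrow> ('g \<Rightarrow> complex) \<Rightarrow>
   ('g \<Rightarrow> complex) set"
where
  "L2chi G H s \<mu> chi =
     {F. (\<forall>g\<in>carrier G. \<forall>h\<in>H. F (g \<otimes>\<^bsub>G\<^esub> h) = chi h * F g) \<and>
         (\<lambda>x. F (s x)) \<in> borel_measurable \<mu> \<and>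
         integrable \<mu> (\<lambda>x. (norm (F (s x)))\<^sup>2)}"

definition L2chi_norm ::
  "('g set \<Rightarrow> 'g) \<Rightarrow> 'g set measure \<Rightarrow> ('g \<Rightarrow> complex) \<Rightarrow> real"
where "L2chi_norm s \<mu> F = sqrt (LINT x|\<mu>. (norm (F (s x)))\<^sup>2)"

definition L2chi_inner ::
  "('g set \<Rightarrow> 'g) \<Rightarrow> 'g set measure \<Rightarrow> ('g \<Rightarrow> complex) \<Rightarrow> ('g \<Rightarrow> complex) \<Rightarrow> complex"
where "L2chi_inner s \<mu> F F' = (LINT x|\<mu>. F (s x) * cnj (F' (s x)))"

text \<open>
  Elements of \<open>L2chi\<close> represent the same vector when they agree at \<open>s x\<close> for almost all \<open>x\<close>.
\<close>

definition L2chi_eq ::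
  "('g set \<Rightarrow> 'g) \<Rightarrow> 'g set measure \<Rightarrow> ('g \<Rightarrow> complex) \<Rightarrow> ('g \<Rightarrow> complex) \<Rightarrow> bool"
where "L2chi_eq s \<mu> F F' \<longleftrightarrow> (AE x in \<mu>. F (s x) = F' (s x))"

text \<open>
  \<open>\<rho>\<close> is realised, through the linear isometry \<open>J\<close>, by left translations on an invariant closed
  subspace of \<open>L2chi\<close>. The subspace may be proper: for the Heisenberg group and its centre the
  left translations on all of \<open>L2chi\<close> are reducible, and the irreducible square integrable
  representation lives on a proper subspace.
\<close>

definition induced_representation ::
  "('g, 'm) monoid_scheme \<Rightarrow> 'g set \<Rightarrow> ('g set \<Rightarrow> 'g) \<Rightarrow> 'g set measure \<Rightarrow> ('g \<Rightarrow> complex) \<Rightarrow>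
   ('g \<Rightarrow> 'v::complex_hilbert \<Rightarrow> 'v) \<Rightarrow> bool"
where
  "induced_representation G H s \<mu> chi \<rho> \<longleftrightarrow>
     (\<exists>J :: 'v \<Rightarrow> 'g \<Rightarrow> complex.
        (\<forall>v. J v \<in> L2chi G H s \<mu> chi \<and> L2chi_norm s \<mu> (J v) = norm v) \<and>
        (\<forall>u v. L2chi_eq s \<mu> (J (u + v)) (\<lambda>g. J u g + J v g)) \<and>
        (\<forall>a v. L2chi_eq s \<mu> (J (a *\<^sub>C v)) (\<lambda>g. a * J v g)) \<and>
        (\<forall>g\<in>carrier G. \<forall>v. L2chi_eq s \<mu> (J (\<rho> g v)) (\<lambda>g'. J v (inv\<^bsub>G\<^esub> g \<otimes>\<^bsub>G\<^esub> g'))))"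

definition covariant_transform ::
  "('g \<Rightarrow> 'v::complex_hilbert \<Rightarrow> 'v) \<Rightarrow> 'v \<Rightarrow> 'v \<Rightarrow> 'g \<Rightarrow> complex"
where "covariant_transform \<rho> \<phi> v g = cinner v (\<rho> g \<phi>)"

definition contravariant_integrand ::
  "('g set \<Rightarrow> 'g) \<Rightarrow> ('g \<Rightarrow> 'v::complex_hilbert \<Rightarrow> 'v) \<Rightarrow> 'v \<Rightarrow> ('g \<Rightarrow> complex) \<Rightarrow> 'g set \<Rightarrow> 'v"
where "contravariant_integrand s \<rho> \<phi> F x = F (s x) *\<^sub>C \<rho> (s x) \<phi>"

definition contravariant_transform ::
  "('g set \<Rightarrow> 'g) \<Rightarrow> 'g set measure \<Rightarrow> ('g \<Rightarrow> 'v::complex_hilbert \<Rightarrow> 'v) \<Rightarrow> 'v \<Rightarrow>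
   ('g \<Rightarrow> complex) \<Rightarrow> 'v"
where "contravariant_transform s \<mu> \<rho> \<phi> F = weak_integral \<mu> (contravariant_integrand s \<rho> \<phi> F)"

text \<open>
  Square integrability of \<open>\<rho>\<close> modulo \<open>H\<close>, together with the normalisation of the admissible
  vector \<open>\<phi>\<close>. The last conjunct says that the contravariant transform is isometric on the
  orthogonal complement of its kernel.
\<close>

definition admissible_vector ::
  "('g, 'm) monoid_scheme \<Rightarrow> 'g set \<Rightarrow> ('g set \<Rightarrow> 'g) \<Rightarrow> 'g set measure \<Rightarrow> ('g \<Rightarrow> complex) \<Rightarrow>
   ('g \<Rightarrow> 'v::complex_hilbert \<Rightarrow> 'v) \<Rightarrow> 'v \<Rightarrow> bool"
where
  "admissible_vector G H s \<mu> chi \<rho> \<phi> \<longleftrightarrow>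
     norm \<phi> = 1 \<and>
     (\<forall>v. covariant_transform \<rho> \<phi> v \<in> L2chi G H s \<mu> chi \<and>
          L2chi_norm s \<mu> (covariant_transform \<rho> \<phi> v) = norm v) \<and>
     (\<forall>g\<in>carrier G. \<forall>v.
        has_weak_integral \<mu>
          (contravariant_integrand s \<rho> \<phi> (covariant_transform \<rho> (\<rho> g \<phi>) v))
          (cinner \<phi> (\<rho> g \<phi>) *\<^sub>C v)) \<and>
     (\<forall>F\<in>L2chi G H s \<mu> chi.
        has_weak_integral \<mu> (contravariant_integrand s \<rho> \<phi> F)
          (contravariant_transform s \<mu> \<rho> \<phi> F) \<and>
        norm (contravariant_transform s \<mu> \<rho> \<phi> F) \<le> L2chi_norm s \<mu> F) \<and>
     (\<forall>F\<in>L2chi G H s \<mu> chi.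
        (\<forall>F'\<in>L2chi G H s \<mu> chi.
           contravariant_transform s \<mu> \<rho> \<phi> F' = 0 \<longrightarrow> L2chi_inner s \<mu> F F' = 0) \<longrightarrow>
        norm (contravariant_transform s \<mu> \<rho> \<phi> F) = L2chi_norm s \<mu> F)"


subsection \<open>Relative convolutions\<close>

definition relative_convolution ::
  "('g set \<Rightarrow> 'g) \<Rightarrow> 'g set measure \<Rightarrow> ('g \<Rightarrow> 'v::complex_hilbert \<Rightarrow> 'v) \<Rightarrow>
   ('g set \<Rightarrow> complex) \<Rightarrow> 'v \<Rightarrow> 'v"
where "relative_convolution s \<mu> \<rho> k v = weak_integral \<mu> (\<lambda>x. k x *\<^sub>C \<rho> (s x) v)"

definition frown ::
  "('g, 'm) monoid_scheme \<Rightarrow> ('g set \<Rightarrow> 'g) \<Rightarrow> 'g set measure \<Rightarrow> ('g \<Rightarrow> complex) \<Rightarrow>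
   ('g set \<Rightarrow> complex) \<Rightarrow> 'g \<Rightarrow> complex"
where
  "frown G s \<mu> chi k g =
     (LINT x|\<mu>. k x * chi (inv\<^bsub>G\<^esub> g \<otimes>\<^bsub>G\<^esub> inv\<^bsub>G\<^esub> (s x) \<otimes>\<^bsub>G\<^esub> g \<otimes>\<^bsub>G\<^esub> s x))"

end

theory Submission
  imports Defs
begin

text \<open>
  Put \<open>k = f / \<Phi>\<close> and write \<open>W\<close> and \<open>M\<close> for the covariant and contravariant transforms of
  \<open>\<phi>\<close>. The reproducing formula for the vector \<open>\<rho> (s x) \<phi>\<close> turns \<open>\<Phi> (s x) \<rho> (s x) v\<close> into \<open>M\<close> of
  \<open>g \<mapsto> \<langle>\<rho> (s x) v, \<rho> (g s x) \<phi>\<rangle> = W v (s x\<inverse> g s x)\<close>, and this is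
  \<open>chi (g\<inverse> s x\<inverse> g s x) W v g\<close> because the commutator lies in \<open>H\<close>. Integrating against \<open>k\<close> and
  exchanging the integrals gives \<open>\<rho> f v = M (frown k \<cdot> W v)\<close>, and \<open>M\<close> is a contraction while \<open>W\<close>
  is an isometry. Fubini applies since \<open>\<Phi> \<circ> s\<close> is square integrable without zeros, so that \<open>\<mu>\<close> is
  \<open>\<sigma>\<close>-finite, and since the twisted kernel is continuous on the second countable \<open>G \<times> G\<close>.
\<close>

subsection \<open>Complex Hilbert spaces and weak integrals\<close>

lemma cinner_add_right: "cinner x (y + z) = cinner x y + cinner x (z :: 'v::complex_hilbert)"
  by (metis cinner_add_left cinner_commute complex_cnj_add)

lemma cinner_scaleC_right: "cinner x (a *\<^sub>C y) = cnj a * cinner x (y :: 'v::complex_hilbert)"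
  by (metis cinner_scaleC_left cinner_commute complex_cnj_mult)

lemma cinner_diff_left: "cinner (x - y) z = cinner x z - cinner y (z :: 'v::complex_hilbert)"
  by (metis add_diff_cancel cinner_add_left diff_add_cancel)

lemma cinner_diff_right: "cinner x (y - z) = cinner x y - cinner x (z :: 'v::complex_hilbert)"
  by (metis add_diff_cancel cinner_add_right diff_add_cancel)

text \<open>Subtracting from \<open>x\<close> its projection \<open>a *\<^sub>C y\<close> leaves a
  vector orthogonal to \<open>y\<close>; its squared norm is nonnegative.\<close>

lemma cinner_Cauchy_Schwarz: "norm (cinner x y) \<le> norm x * norm (y :: 'v::complex_hilbert)"
proof (cases "y = 0")
  case True
  have "cinner x 0 = 0" using cinner_diff_right[of x 0 0] by simp
  with True show ?thesis by simp
next
  case False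
  define a where "a = cinner x y / complex_of_real ((norm y)\<^sup>2)"
  have a: "a * complex_of_real ((norm y)\<^sup>2) = cinner x y"
    using False by (simp add: a_def del: of_real_power)
  have "cinner (x - a *\<^sub>C y) y = 0"
    by (simp add: cinner_diff_left cinner_scaleC_left cinner_norm a del: of_real_power)
  then have "cinner (x - a *\<^sub>C y) (x - a *\<^sub>C y) = cinner (x - a *\<^sub>C y) x"
    by (simp add: cinner_diff_right cinner_scaleC_right)
  also have "\<dots> = complex_of_real ((norm x)\<^sup>2) - a * cnj (cinner x y)"
    by (simp add: cinner_diff_left cinner_scaleC_left cinner_norm flip: cinner_commute)
  also have "a * cnj (cinner x y) = complex_of_real ((norm (cinner x y))\<^sup>2 / (norm y)\<^sup>2)"
    by (simp add: a_def complex_norm_square del: of_real_power)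
  finally have "(norm (x - a *\<^sub>C y))\<^sup>2 = (norm x)\<^sup>2 - (norm (cinner x y))\<^sup>2 / (norm y)\<^sup>2"
    unfolding cinner_norm of_real_diff [symmetric] of_real_eq_iff .
  then have "(norm (cinner x y))\<^sup>2 / (norm y)\<^sup>2 \<le> (norm x)\<^sup>2"
    by (metis diff_ge_0_iff_ge zero_le_power2)
  then have "(norm (cinner x y))\<^sup>2 \<le> (norm x * norm y)\<^sup>2"
    using False by (simp add: pos_divide_le_eq power_mult_distrib)
  then show ?thesis by (rule power2_le_imp_le) simp
qed

text \<open>\<open>cinner v\<close> is conjugate linear, hence real linear, and Cauchy-Schwarz
  bounds it. This makes matrix coefficients of a strongly continuous representation
  continuous.\<close>

lemma continuous_on_cinner_right: "continuous_on S (cinner (v :: 'v::complex_hilbert))"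
proof -
  have "bounded_linear (cinner v)"
  proof (rule bounded_linear_intro)
    show "cinner v (r *\<^sub>R x) = r *\<^sub>R cinner v x" for r x
      by (simp add: cinner_scaleC_right scaleR_conv_of_real flip: scaleC_of_real)
    show "norm (cinner v x) \<le> norm x * norm v" for x
      by (metis cinner_Cauchy_Schwarz mult.commute)
  qed (rule cinner_add_right)
  then show ?thesis by (rule linear_continuous_on)
qed

lemma cinner_ext:
  assumes "\<And>w. cinner u w = cinner (v :: 'v::complex_hilbert) w"
  shows "u = v"
proof -
  have "cinner (u - v) (u - v) = 0" by (simp add: cinner_diff_left assms)
  then show ?thesis by (simp add: cinner_norm)
qed

text \<open>A vector is determined by its inner products, so the definite description in
  \<open>weak_integral\<close> denotes whichever weak integral has been found.\<close>

lemma has_weak_integral_unique: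
  "has_weak_integral M F u \<Longrightarrow> has_weak_integral M F v \<Longrightarrow> u = v"
  unfolding has_weak_integral_def by (metis cinner_ext)

lemma weak_integral_eqI: "has_weak_integral M F u \<Longrightarrow> weak_integral M F = u"
  unfolding weak_integral_def by (blast intro: has_weak_integral_unique)

lemma has_weak_integral_cong:
  "(\<And>x. x \<in> space M \<Longrightarrow> F x = F' x) \<Longrightarrow> has_weak_integral M F u \<longleftrightarrow> has_weak_integral M F' u"
  by (simp add: has_weak_integral_def cong: Bochner_Integration.integrable_cong
      Bochner_Integration.integral_cong)

lemma has_weak_integral_add:
  assumes "has_weak_integral M F u" "has_weak_integral M F' u'"
  shows "has_weak_integral M (\<lambda>x. F x + F' x) (u + u')"
  using assms by (simp add: has_weak_integral_def cinner_add_left)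

lemma has_weak_integral_scaleC:
  assumes "has_weak_integral M F u"
  shows "has_weak_integral M (\<lambda>x. a *\<^sub>C F x) (a *\<^sub>C u)"
  using assms by (simp add: has_weak_integral_def cinner_scaleC_left)


subsection \<open>Measurability of continuous maps on products\<close>

text \<open>\<open>G\<close> and \<open>G/H\<close> are topologised by values of type
  \<open>topology\<close>, not through a type class. Only the sigma-algebra of this measure
  matters.\<close>

definition borel_of :: "'a topology \<Rightarrow> 'a measure"
  where "borel_of T = sigma (topspace T) {U. openin T U}"

lemma space_borel_of [simp]: "space (borel_of T) = topspace T"
  and sets_borel_of_openin: "openin T U \<Longrightarrow> U \<in> sets (borel_of T)"
proof -
  have "{U. openin T U} \<subseteq> Pow (topspace T)" by (auto dest: openin_subset)
  then show "space (borel_of T) = topspace T"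
    "openin T U \<Longrightarrow> U \<in> sets (borel_of T)"
    by (auto simp: borel_of_def sets_measure_of)
qed

lemma borel_of_measurableI:
  assumes "\<And>U. openin T U \<Longrightarrow> f -` U \<inter> space M \<in> sets M" "f \<in> space M \<rightarrow> topspace T"
  shows "f \<in> measurable M (borel_of T)"
  unfolding borel_of_def by (rule measurable_measure_of) (use assms in \<open>auto dest: openin_subset\<close>)

text \<open>An open set of the product is a union of rectangles from two countable bases, hence a
  countable union, so it lies in the product sigma-algebra.\<close>

lemma borel_measurable_pair_continuous_map:
  fixes f :: "'a \<times> 'b \<Rightarrow> 'c::topological_space"
  assumes S: "second_countable S" and T: "second_countable T"
    and f: "continuous_map (prod_topology S T) euclidean f"
  shows "f \<in> borel_measurable (borel_of S \<Otimes>\<^sub>M borel_of T)"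
proof (rule borel_measurableI)
  fix V :: "'c set" assume "open V"
  define W where "W = f -` V \<inter> space (borel_of S \<Otimes>\<^sub>M borel_of T)"
  have "openin (prod_topology S T) {z \<in> topspace (prod_topology S T). f z \<in> V}"
    using openin_continuous_map_preimage[OF f] \<open>open V\<close> by simp
  moreover have "{z \<in> topspace (prod_topology S T). f z \<in> V} = W"
    by (auto simp: W_def space_pair_measure)
  ultimately have W: "openin (prod_topology S T) W" by simp
  obtain \<B> where B: "countable \<B>" "\<forall>U\<in>\<B>. openin S U"
    "\<forall>U x. openin S U \<and> x \<in> U \<longrightarrow> (\<exists>V\<in>\<B>. x \<in> V \<and> V \<subseteq> U)"
    using S unfolding second_countable_def by (elim exE conjE)
  obtain \<C> where C: "countable \<C>" "\<forall>U\<in>\<C>. openin T U"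
    "\<forall>U x. openin T U \<and> x \<in> U \<longrightarrow> (\<exists>V\<in>\<C>. x \<in> V \<and> V \<subseteq> U)"
    using T unfolding second_countable_def by (elim exE conjE)
  define R where "R = {(B, C) \<in> \<B> \<times> \<C>. B \<times> C \<subseteq> W}"
  have "countable R"
  proof (rule countable_subset)
    show "R \<subseteq> \<B> \<times> \<C>" by (auto simp: R_def)
  qed (simp add: B(1) C(1))
  have "W = (\<Union>(B, C)\<in>R. B \<times> C)"
  proof
    show "W \<subseteq> (\<Union>(B, C)\<in>R. B \<times> C)"
    proof clarify
      fix x y assume "(x, y) \<in> W"
      then obtain U U' where U: "openin S U" "openin T U'" "x \<in> U" "y \<in> U'" "U \<times> U' \<subseteq> W"
        using W unfolding openin_prod_topology_alt by metis
      obtain B' where B': "B' \<in> \<B>" "x \<in> B'" "B' \<subseteq> U" using B(3) U(1,3) by metis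
      obtain C' where C': "C' \<in> \<C>" "y \<in> C'" "C' \<subseteq> U'" using C(3) U(2,4) by metis
      have "(B', C') \<in> R" using B' C' U(5) by (auto simp: R_def)
      with B'(2) C'(2) show "(x, y) \<in> (\<Union>(B, C)\<in>R. B \<times> C)" by blast
    qed
  qed (auto simp: R_def)
  also have "\<dots> \<in> sets (borel_of S \<Otimes>\<^sub>M borel_of T)"
  proof (rule sets.countable_UN'[OF \<open>countable R\<close>], clarify)
    fix B' C' assume "(B', C') \<in> R"
    then have "openin S B'" "openin T C'" using B(2) C(2) by (auto simp: R_def)
    then show "B' \<times> C' \<in> sets (borel_of S \<Otimes>\<^sub>M borel_of T)"
      by (intro pair_measureI sets_borel_of_openin)
  qed
  finally show "f -` V \<inter> space (borel_of S \<Otimes>\<^sub>M borel_of T) \<in> sets (borel_of S \<Otimes>\<^sub>M borel_of T)"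
    by (simp add: W_def)
qed

text \<open>By Markov's inequality the sets where \<open>u\<close> is at least
  \<open>1 / Suc n\<close> have finite measure; positivity of \<open>u\<close> makes them exhaust
  the space.\<close>

lemma sigma_finite_measure_integrable_pos:
  fixes u :: "'a \<Rightarrow> real"
  assumes u: "integrable M u" and pos: "\<And>x. x \<in> space M \<Longrightarrow> u x > 0"
  shows "sigma_finite_measure M"
proof
  define A where "A n = {x \<in> space M. u x \<ge> 1 / real (Suc n)}" for n
  have [measurable]: "u \<in> borel_measurable M" using u by simp
  have sets: "A n \<in> sets M" for n unfolding A_def by measurable
  have "emeasure M (A n) < \<infinity>" for n
  proof -
    have "emeasure M (A n) \<le> (1 / (1 / real (Suc n))) * (\<integral>x. u x \<partial>M)"
      unfolding A_def
      by (rule integral_Markov_inequality[OF u]) (use pos in \<open>auto intro!: AE_I2 less_imp_le\<close>)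
    then show ?thesis by (rule le_less_trans) simp
  qed
  moreover have "(\<Union>n. A n) = space M"
  proof -
    have "\<exists>n. 1 / real (Suc n) \<le> u x" if "x \<in> space M" for x
      using reals_Archimedean[OF pos[OF that]] by (metis inverse_eq_divide less_imp_le)
    then show ?thesis by (auto simp: A_def)
  qed
  ultimately show "\<exists>A. countable A \<and> A \<subseteq> sets M \<and> \<Union> A = space M \<and> (\<forall>a\<in>A. emeasure M a \<noteq> \<infinity>)"
    using sets by (intro exI[of _ "range A"]) (auto simp: less_top)
qed

subsection \<open>The twisted integral over \<open>G/H \<times> G/H\<close>\<close>

lemma topspace_coset_topology:
  assumes "topspace T = carrier G"
  shows "topspace (coset_topology G T H) = lcosets\<^bsub>G\<^esub> H"
proof
  show "topspace (coset_topology G T H) \<subseteq> lcosets\<^bsub>G\<^esub> H"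
    by (auto simp: topspace_def openin_coset_topology)
  have "{g \<in> topspace T. g <#\<^bsub>G\<^esub> H \<in> lcosets\<^bsub>G\<^esub> H} = topspace T"
    by (auto simp: LCOSETS_def assms)
  then have "openin (coset_topology G T H) (lcosets\<^bsub>G\<^esub> H)"
    by (simp add: openin_coset_topology)
  then show "lcosets\<^bsub>G\<^esub> H \<subseteq> topspace (coset_topology G T H)" by (rule openin_subset)
qed

text \<open>The Lie group enters through its topology, second countable with continuous operations;
  \<open>nonvanishing\<close> is the condition on \<open>\<Phi>\<close> unfolded.\<close>

locale admissible_setting =
  group G + subgroup H G
  for G :: "('g, 'm) monoid_scheme" (structure) and H :: "'g set" +
  fixes T :: "'g topology" and s :: "'g set \<Rightarrow> 'g" and \<mu> :: "'g set measure"
    and chi :: "'g \<Rightarrow> complex" and \<rho> :: "'g \<Rightarrow> 'v::complex_hilbert \<Rightarrow> 'v" and \<phi> :: 'v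
  assumes topspace_eq: "topspace T = carrier G"
    and second_countable: "second_countable T"
    and continuous_mult: "continuous_map (prod_topology T T) T (\<lambda>(g, h). g \<otimes> h)"
    and continuous_inv: "continuous_map T T (\<lambda>g. inv g)"
    and complemented: "complemented_commutator G T H s"
    and invariant: "invariant_measure G T H \<mu>"
    and character: "unitary_character G T H chi"
    and representation: "unitary_representation G T \<rho>"
    and admissible: "admissible_vector G H s \<mu> chi \<rho> \<phi>"
    and nonvanishing: "\<And>x. x \<in> lcosets H \<Longrightarrow> cinner \<phi> (\<rho> (s x) \<phi>) \<noteq> 0"
begin

section \<open>The section and the measure on \<open>G/H\<close>\<close>

lemma s_coset: "x \<in> lcosets H \<Longrightarrow> s x <# H = x"
  using complemented by (simp add: complemented_commutator_def continuous_section_def)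

lemma continuous_s: "continuous_map (coset_topology G T H) T s"
  using complemented by (simp add: complemented_commutator_def continuous_section_def)

lemma s_closed: "x \<in> lcosets H \<Longrightarrow> s x \<in> carrier G"
  using continuous_map_funspace[OF continuous_s]
  by (auto simp: topspace_coset_topology topspace_eq)

lemma sets_mu: "sets \<mu> = sets (borel_of (coset_topology G T H))"
  using invariant
  by (simp add: invariant_measure_def borel_of_def topspace_coset_topology topspace_eq)

lemma space_mu: "space \<mu> = lcosets H"
  using sets_eq_imp_space_eq[OF sets_mu] by (simp add: topspace_coset_topology topspace_eq)

text \<open>The sigma-algebra of \<open>\<mu>\<close> is the Borel one of the coset topology, so
  continuity of \<open>s\<close> suffices.\<close>

lemma measurable_s: "s \<in> measurable \<mu> (borel_of T)"
proof (rule borel_of_measurableI)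
  fix U assume "openin T U"
  then have "openin (coset_topology G T H) {x \<in> topspace (coset_topology G T H). s x \<in> U}"
    by (rule openin_continuous_map_preimage[OF continuous_s])
  moreover have "{x \<in> topspace (coset_topology G T H). s x \<in> U} = s -` U \<inter> space \<mu>"
    by (auto simp: space_mu topspace_coset_topology topspace_eq)
  ultimately show "s -` U \<inter> space \<mu> \<in> sets \<mu>"
    unfolding sets_mu by (simp add: sets_borel_of_openin)
qed (simp add: space_mu s_closed topspace_eq)

section \<open>Unitarity of \<open>\<rho>\<close> and square integrability of its
  coefficients\<close>

lemma rho_mult: "g \<in> carrier G \<Longrightarrow> h \<in> carrier G \<Longrightarrow> \<rho> (g \<otimes> h) v = \<rho> g (\<rho> h v)"
  using representation by (simp add: unitary_representation_def)

lemma rho_cinner: "g \<in> carrier G \<Longrightarrow> cinner (\<rho> g u) (\<rho> g v) = cinner u v"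
  using representation by (simp add: unitary_representation_def unitary_operator_def)

lemma rho_add: "g \<in> carrier G \<Longrightarrow> \<rho> g (u + v) = \<rho> g u + \<rho> g v"
  using representation by (simp add: unitary_representation_def unitary_operator_def)

lemma rho_scaleC: "g \<in> carrier G \<Longrightarrow> \<rho> g (a *\<^sub>C v) = a *\<^sub>C \<rho> g v"
  using representation by (simp add: unitary_representation_def unitary_operator_def)

lemma covariant_L2chi: "covariant_transform \<rho> \<phi> v \<in> L2chi G H s \<mu> chi"
  using admissible by (simp add: admissible_vector_def)

lemma covariant_isometry: "L2chi_norm s \<mu> (covariant_transform \<rho> \<phi> v) = norm v"
  using admissible by (simp add: admissible_vector_def)

lemma covariant_equivariant:
  "g \<in> carrier G \<Longrightarrow> h \<in> H \<Longrightarrow> cinner v (\<rho> (g \<otimes> h) \<phi>) = chi h * cinner v (\<rho> g \<phi>)"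
  using covariant_L2chi[of v] by (simp add: L2chi_def covariant_transform_def)

lemma borel_measurable_covariant: "(\<lambda>x. cinner v (\<rho> (s x) \<phi>)) \<in> borel_measurable \<mu>"
  and integrable_covariant_square: "integrable \<mu> (\<lambda>x. (norm (cinner v (\<rho> (s x) \<phi>)))\<^sup>2)"
  using covariant_L2chi[of v] by (simp_all add: L2chi_def covariant_transform_def)

text \<open>The product is dominated by the sum of the squares.\<close>

lemma integrable_covariant_mult:
  "integrable \<mu> (\<lambda>x. norm (cinner v (\<rho> (s x) \<phi>)) * norm (cinner w (\<rho> (s x) \<phi>)))"
proof (rule Bochner_Integration.integrable_bound)
  show "integrable \<mu> (\<lambda>x. (norm (cinner v (\<rho> (s x) \<phi>)))\<^sup>2 + (norm (cinner w (\<rho> (s x) \<phi>)))\<^sup>2)"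
    by (intro Bochner_Integration.integrable_add integrable_covariant_square)
  note [measurable] = borel_measurable_covariant
  show "(\<lambda>x. norm (cinner v (\<rho> (s x) \<phi>)) * norm (cinner w (\<rho> (s x) \<phi>))) \<in> borel_measurable \<mu>"
    by measurable
  have "a * b \<le> a\<^sup>2 + b\<^sup>2" if "0 \<le> a" "0 \<le> b" for a b :: real
    using sum_squares_bound[of a b] mult_nonneg_nonneg[OF that] by linarith
  then show "AE x in \<mu>. norm (norm (cinner v (\<rho> (s x) \<phi>)) * norm (cinner w (\<rho> (s x) \<phi>)))
      \<le> norm ((norm (cinner v (\<rho> (s x) \<phi>)))\<^sup>2 + (norm (cinner w (\<rho> (s x) \<phi>)))\<^sup>2)"
    by simp
qed

lemma sigma_finite_mu: "sigma_finite_measure \<mu>"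
  by (rule sigma_finite_measure_integrable_pos[OF integrable_covariant_square[of \<phi>]])
     (simp add: space_mu nonvanishing)

section \<open>Conjugation by the section and the commutator factor\<close>

lemma cinner_translate:
  assumes "a \<in> carrier G" "b \<in> carrier G"
  shows "cinner (\<rho> a v) (\<rho> b (\<rho> a \<phi>)) = cinner v (\<rho> (inv a \<otimes> b \<otimes> a) \<phi>)"
proof -
  \<comment> \<open>The conjugate is what remains once \<open>\<rho> a\<close> is pulled out on the
    left, where unitarity cancels it.\<close>
  have "a \<otimes> (inv a \<otimes> b \<otimes> a) = b \<otimes> a"
    using assms by (simp add: m_assoc[symmetric])
  then have "\<rho> b (\<rho> a \<phi>) = \<rho> a (\<rho> (inv a \<otimes> b \<otimes> a) \<phi>)"
    using assms by (simp flip: rho_mult)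
  then show ?thesis using assms by (simp add: rho_cinner)
qed

text \<open>The complemented commutator property puts the conjugate of \<open>g\<close> into the
  coset \<open>g <# H\<close>; dividing by \<open>g\<close> on the left lands in
  \<open>H\<close>.\<close>

lemma commutator_mem:
  assumes "x \<in> lcosets H" "g \<in> carrier G"
  shows "inv g \<otimes> inv (s x) \<otimes> g \<otimes> s x \<in> H"
proof -
  let ?c = "inv (s x) \<otimes> g \<otimes> s x"
  have s: "s x \<in> carrier G" using assms by (simp add: s_closed)
  have "?c <# H = g <# H"
    using complemented assms by (simp add: complemented_commutator_def)
  moreover have "?c \<in> ?c <# H"
    using s assms by (intro lcos_self) (auto simp: subgroup_axioms)
  ultimately have "inv g \<otimes> ?c \<in> H"
    using lcos_module_imp[OF is_group assms(2)] by simp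
  then show ?thesis using s assms by (simp add: m_assoc)
qed

text \<open>The conjugate is \<open>g\<close> times the commutator, to which equivariance
  applies.\<close>

lemma cinner_conjugate:
  assumes "x \<in> lcosets H" "g \<in> carrier G"
  shows "cinner v (\<rho> (inv (s x) \<otimes> g \<otimes> s x) \<phi>) =
    chi (inv g \<otimes> inv (s x) \<otimes> g \<otimes> s x) * cinner v (\<rho> g \<phi>)"
proof -
  have s: "s x \<in> carrier G" using assms by (simp add: s_closed)
  have "inv (s x) \<otimes> g \<otimes> s x = g \<otimes> (inv g \<otimes> inv (s x) \<otimes> g \<otimes> s x)"
    using s assms by (simp add: m_assoc[symmetric])
  then show ?thesis
    using covariant_equivariant[OF assms(2) commutator_mem[OF assms]] by simp
qed

lemma norm_chi_commutator:
  "x \<in> lcosets H \<Longrightarrow> g \<in> carrier G \<Longrightarrow> norm (chi (inv g \<otimes> inv (s x) \<otimes> g \<otimes> s x)) = 1"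
  using character commutator_mem by (simp add: unitary_character_def)

text \<open>The commutator factor is unimodular. For integrable \<open>k\<close> this keeps the
  supremum of \<open>frown\<close> finite.\<close>

lemma norm_frown_le:
  assumes "g \<in> carrier G"
  shows "norm (frown G s \<mu> chi k g) \<le> (LINT x|\<mu>. norm (k x))"
proof -
  have "norm (frown G s \<mu> chi k g) \<le>
      (LINT x|\<mu>. norm (k x * chi (inv g \<otimes> inv (s x) \<otimes> g \<otimes> s x)))"
    unfolding frown_def by (rule integral_norm_bound)
  also have "\<dots> = (LINT x|\<mu>. norm (k x))"
    by (rule Bochner_Integration.integral_cong)
       (simp_all add: norm_mult norm_chi_commutator assms space_mu)
  finally show ?thesis .
qed

text \<open>The coefficient at \<open>g\<close> is constant in \<open>x\<close> and moves under the
  integral. The resulting form is free of \<open>chi\<close>, so its measurability follows from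
  continuity of \<open>\<rho>\<close> and \<open>s\<close>.\<close>

lemma frown_mult_covariant:
  assumes "g \<in> carrier G"
  shows "frown G s \<mu> chi k g * cinner v (\<rho> g \<phi>) =
    (LINT x|\<mu>. k x * cinner v (\<rho> (inv (s x) \<otimes> g \<otimes> s x) \<phi>))"
proof -
  have "frown G s \<mu> chi k g * cinner v (\<rho> g \<phi>) =
      (LINT x|\<mu>. k x * chi (inv g \<otimes> inv (s x) \<otimes> g \<otimes> s x) * cinner v (\<rho> g \<phi>))"
    by (simp add: frown_def)
  also have "\<dots> = (LINT x|\<mu>. k x * cinner v (\<rho> (inv (s x) \<otimes> g \<otimes> s x) \<phi>))"
    by (rule Bochner_Integration.integral_cong)
       (simp_all add: cinner_conjugate assms space_mu mult.assoc)
  finally show ?thesis .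
qed

section \<open>Joint measurability of the conjugated coefficient\<close>

lemma continuous_map_cinner_conjugate:
  "continuous_map (prod_topology T T) euclidean (\<lambda>(a, b). cinner v (\<rho> (inv a \<otimes> b \<otimes> a) \<phi>))"
proof -
  let ?TT = "prod_topology T T"
  have mult: "continuous_map ?TT T (\<lambda>z. p z \<otimes> q z)"
    if "continuous_map ?TT T p" "continuous_map ?TT T q" for p q
    using continuous_map_compose[OF continuous_map_pairedI[OF that] continuous_mult]
    by (simp add: o_def)
  have inv: "continuous_map ?TT T (\<lambda>z. inv (fst z))"
    using continuous_map_compose[OF continuous_map_fst continuous_inv] by (simp add: o_def)
  have "continuous_map ?TT T (\<lambda>z. inv (fst z) \<otimes> snd z \<otimes> fst z)"
    by (intro mult inv continuous_map_fst continuous_map_snd)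
  moreover have "continuous_map T euclidean (\<lambda>g. \<rho> g \<phi>)"
    using representation by (simp add: unitary_representation_def)
  moreover have "continuous_map euclidean euclidean (cinner v)"
    by (simp add: continuous_on_cinner_right)
  ultimately have "continuous_map ?TT euclidean
      (cinner v \<circ> ((\<lambda>g. \<rho> g \<phi>) \<circ> (\<lambda>z. inv (fst z) \<otimes> snd z \<otimes> fst z)))"
    by (intro continuous_map_compose)
  then show ?thesis by (simp add: o_def case_prod_beta')
qed

text \<open>Measurability is obtained on \<open>G \<times> G\<close>, where second countability is
  at hand, and pulled back along \<open>s\<close> in both variables.\<close>

lemma borel_measurable_cinner_conjugate:
  "(\<lambda>(x, y). cinner v (\<rho> (inv (s x) \<otimes> s y \<otimes> s x) \<phi>)) \<in> borel_measurable (\<mu> \<Otimes>\<^sub>M \<mu>)"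
proof -
  note [measurable] = measurable_s
    borel_measurable_pair_continuous_map[OF second_countable second_countable
      continuous_map_cinner_conjugate]
  have "(\<lambda>(a, b). cinner v (\<rho> (inv a \<otimes> b \<otimes> a) \<phi>)) \<circ> (\<lambda>(x, y). (s x, s y))
      \<in> borel_measurable (\<mu> \<Otimes>\<^sub>M \<mu>)"
    by (rule measurable_comp[where N = "borel_of T \<Otimes>\<^sub>M borel_of T"]) measurable
  then show ?thesis by (simp add: o_def case_prod_beta')
qed

section \<open>The reproducing formula and integrability on the product\<close>

lemma reproducing_translate:
  assumes "x \<in> lcosets H"
  shows "(LINT y|\<mu>. cinner v (\<rho> (inv (s x) \<otimes> s y \<otimes> s x) \<phi>) * cinner (\<rho> (s y) \<phi>) w) =
    cinner \<phi> (\<rho> (s x) \<phi>) * cinner (\<rho> (s x) v) w"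
proof -
  have sx: "s x \<in> carrier G" using assms by (rule s_closed)
  \<comment> \<open>Admissibility is used at \<open>g = s x\<close> for the vector
    \<open>\<rho> (s x) v\<close>; \<open>cinner_translate\<close> then turns both translations into
    one conjugation.\<close>
  have "has_weak_integral \<mu>
      (contravariant_integrand s \<rho> \<phi> (covariant_transform \<rho> (\<rho> (s x) \<phi>) (\<rho> (s x) v)))
      (cinner \<phi> (\<rho> (s x) \<phi>) *\<^sub>C \<rho> (s x) v)"
    using admissible sx by (simp add: admissible_vector_def)
  then have "(LINT y|\<mu>. cinner (\<rho> (s x) v) (\<rho> (s y) (\<rho> (s x) \<phi>)) * cinner (\<rho> (s y) \<phi>) w) =
      cinner \<phi> (\<rho> (s x) \<phi>) * cinner (\<rho> (s x) v) w"
    by (simp add: has_weak_integral_def contravariant_integrand_def covariant_transform_def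
        cinner_scaleC_left)
  moreover have "(LINT y|\<mu>. cinner (\<rho> (s x) v) (\<rho> (s y) (\<rho> (s x) \<phi>)) * cinner (\<rho> (s y) \<phi>) w) =
      (LINT y|\<mu>. cinner v (\<rho> (inv (s x) \<otimes> s y \<otimes> s x) \<phi>) * cinner (\<rho> (s y) \<phi>) w)"
    by (rule Bochner_Integration.integral_cong)
       (simp_all add: cinner_translate sx s_closed space_mu)
  ultimately show ?thesis by simp
qed

text \<open>In absolute value the commutator factor disappears, so the integrand splits into an
  integrable function of \<open>x\<close> times one of \<open>y\<close>.\<close>

lemma integrable_twisted:
  assumes k: "integrable \<mu> k"
  shows "integrable (\<mu> \<Otimes>\<^sub>M \<mu>) (\<lambda>(x, y).
    k x * (cinner v (\<rho> (inv (s x) \<otimes> s y \<otimes> s x) \<phi>) * cinner (\<rho> (s y) \<phi>) w))"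
    (is "integrable _ ?P")
proof -
  interpret sigma_finite_measure \<mu> by (rule sigma_finite_mu)
  interpret pair_sigma_finite \<mu> \<mu> ..
  have norm_P: "norm (?P (x, y)) =
      norm (k x) * (norm (cinner v (\<rho> (s y) \<phi>)) * norm (cinner w (\<rho> (s y) \<phi>)))"
    if "x \<in> lcosets H" "y \<in> lcosets H" for x y
    using that by (simp add: norm_mult cinner_conjugate norm_chi_commutator s_closed)
      (metis cinner_commute complex_mod_cnj)
  \<comment> \<open>Admissibility gives measurability with the arguments in the other order; complex
    conjugation swaps them.\<close>
  have [measurable]: "(\<lambda>y. cinner (\<rho> (s y) \<phi>) w) \<in> borel_measurable \<mu>"
    using measurable_compose[OF borel_measurable_covariant[of w]
        borel_measurable_continuous_onI[OF continuous_on_cnj[OF continuous_on_id]]]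
    by (simp flip: cinner_commute)
  note [measurable] = borel_measurable_integrable[OF k] borel_measurable_cinner_conjugate
  have [measurable]: "?P \<in> borel_measurable (\<mu> \<Otimes>\<^sub>M \<mu>)" by measurable
  show ?thesis
  proof (rule Fubini_integrable)
    have "integrable \<mu> (\<lambda>x. norm (k x) *
        (LINT y|\<mu>. norm (cinner v (\<rho> (s y) \<phi>)) * norm (cinner w (\<rho> (s y) \<phi>))))"
      using k by simp
    also have "?this \<longleftrightarrow> integrable \<mu> (\<lambda>x. LINT y|\<mu>. norm (?P (x, y)))"
    proof (rule Bochner_Integration.integrable_cong)
      fix x assume x: "x \<in> space \<mu>"
      have "(LINT y|\<mu>. norm (?P (x, y))) = (LINT y|\<mu>. norm (k x) *
          (norm (cinner v (\<rho> (s y) \<phi>)) * norm (cinner w (\<rho> (s y) \<phi>))))"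
        using x by (intro Bochner_Integration.integral_cong norm_P) (auto simp: space_mu)
      then show "norm (k x) *
          (LINT y|\<mu>. norm (cinner v (\<rho> (s y) \<phi>)) * norm (cinner w (\<rho> (s y) \<phi>))) =
          (LINT y|\<mu>. norm (?P (x, y)))" by simp
    qed simp
    finally show "integrable \<mu> (\<lambda>x. LINT y|\<mu>. norm (?P (x, y)))" .
    show "AE x in \<mu>. integrable \<mu> (\<lambda>y. ?P (x, y))"
    proof (rule AE_I2)
      fix x assume x: "x \<in> space \<mu>"
      have "integrable \<mu> (\<lambda>y. norm (k x) *
          (norm (cinner v (\<rho> (s y) \<phi>)) * norm (cinner w (\<rho> (s y) \<phi>))))"
        by (intro integrable_mult_right integrable_covariant_mult)
      then have "integrable \<mu> (\<lambda>y. norm (?P (x, y)))"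
        using x by (subst Bochner_Integration.integrable_cong[OF refl norm_P])
          (auto simp: space_mu)
      then show "integrable \<mu> (\<lambda>y. ?P (x, y))"
        by (rule integrable_norm_cancel) (use x in measurable)
    qed
  qed fact
qed

text \<open>
  \<open>F\<close> is \<open>frown k\<close> times the covariant transform of \<open>v\<close>, except that \<open>frown k\<close> is evaluated at the
  representative \<open>s (g H)\<close> of the coset: \<open>frown k\<close> need not be constant on cosets unless \<open>chi\<close> is
  invariant under conjugation by \<open>s x\<close>, and \<open>F\<close> has to be \<open>chi\<close>-equivariant.
\<close>

lemma relative_convolution_eq_contravariant:
  assumes k: "integrable \<mu> k"
    and C: "\<And>g. g \<in> carrier G \<Longrightarrow> norm (frown G s \<mu> chi k g) \<le> C"
  shows "\<exists>u. has_weak_integral \<mu> (\<lambda>x. (k x * cinner \<phi> (\<rho> (s x) \<phi>)) *\<^sub>C \<rho> (s x) v) u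
    \<and> norm u \<le> C * norm v"
proof -
  interpret sigma_finite_measure \<mu> by (rule sigma_finite_mu)
  interpret pair_sigma_finite \<mu> \<mu> ..
  define F where "F g = frown G s \<mu> chi k (s (g <# H)) * cinner v (\<rho> g \<phi>)" for g
  \<comment> \<open>Nonnegativity of \<open>C\<close> is what later turns
    \<open>sqrt (C\<^sup>2)\<close> into \<open>C\<close>.\<close>
  have "norm (frown G s \<mu> chi k \<one>) \<le> C" by (rule C) simp
  then have C0: "0 \<le> C" by (rule order_trans[OF norm_ge_zero])
  \<comment> \<open>At a representative \<open>s (s y <# H) = s y\<close>, so both factors of
    \<open>F\<close> are evaluated at the same point.\<close>
  have F_s: "F (s y) = frown G s \<mu> chi k (s y) * cinner v (\<rho> (s y) \<phi>)" if "y \<in> lcosets H" for y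
    using that by (simp add: F_def s_coset)
  have F_eq: "F (s y) = (LINT x|\<mu>. k x * cinner v (\<rho> (inv (s x) \<otimes> s y \<otimes> s x) \<phi>))"
    if "y \<in> lcosets H" for y
    using that by (simp add: F_s frown_mult_covariant s_closed)
  have F_le: "(norm (F (s y)))\<^sup>2 \<le> C\<^sup>2 * (norm (cinner v (\<rho> (s y) \<phi>)))\<^sup>2" if "y \<in> lcosets H" for y
    unfolding F_s[OF that] norm_mult power_mult_distrib
    by (intro mult_right_mono power_mono C s_closed that) auto
  have F_meas: "(\<lambda>y. F (s y)) \<in> borel_measurable \<mu>"
  proof -
    note [measurable] = borel_measurable_integrable[OF k] borel_measurable_cinner_conjugate
    \<comment> \<open>The variables are swapped because the integral runs over the second
      one.\<close>
    have "(\<lambda>(y, x). k x * cinner v (\<rho> (inv (s x) \<otimes> s y \<otimes> s x) \<phi>)) \<in> borel_measurable (\<mu> \<Otimes>\<^sub>M \<mu>)"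
      by measurable
    then have "(\<lambda>y. LINT x|\<mu>. k x * cinner v (\<rho> (inv (s x) \<otimes> s y \<otimes> s x) \<phi>)) \<in> borel_measurable \<mu>"
      by (rule sigma_finite_measure.borel_measurable_lebesgue_integral[OF sigma_finite_mu])
    then show ?thesis by (subst measurable_cong[OF F_eq]) (auto simp: space_mu)
  qed
  have F_int: "integrable \<mu> (\<lambda>y. (norm (F (s y)))\<^sup>2)"
  proof (rule Bochner_Integration.integrable_bound)
    show "integrable \<mu> (\<lambda>y. C\<^sup>2 * (norm (cinner v (\<rho> (s y) \<phi>)))\<^sup>2)"
      by (intro integrable_mult_right integrable_covariant_square)
  qed (use F_meas F_le in \<open>auto simp: space_mu\<close>)
  have F: "F \<in> L2chi G H s \<mu> chi"
  proof -
    \<comment> \<open>Right multiplication by \<open>h\<close> keeps the coset and thus the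
      \<open>frown\<close> factor; \<open>chi h\<close> comes from the coefficient alone.\<close>
    have "F (g \<otimes> h) = chi h * F g" if "g \<in> carrier G" "h \<in> H" for g h
    proof -
      have "h <# H = H" using that by (simp add: coset_join3 subgroup_axioms)
      then have "(g \<otimes> h) <# H = g <# H"
        using that by (simp add: lcos_m_assoc[symmetric] subset)
      then show ?thesis using that by (simp add: F_def covariant_equivariant)
    qed
    then show ?thesis using F_meas F_int by (simp add: L2chi_def)
  qed
  define u where "u = contravariant_transform s \<mu> \<rho> \<phi> F"
  have u: "has_weak_integral \<mu> (contravariant_integrand s \<rho> \<phi> F) u" "norm u \<le> L2chi_norm s \<mu> F"
    using admissible F by (simp_all add: admissible_vector_def u_def)
  have "L2chi_norm s \<mu> F \<le> sqrt (C\<^sup>2 * (LINT y|\<mu>. (norm (cinner v (\<rho> (s y) \<phi>)))\<^sup>2))"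
    unfolding L2chi_norm_def integral_mult_right_zero[symmetric]
    by (intro real_sqrt_le_mono integral_mono F_int integrable_mult_right
        integrable_covariant_square F_le) (simp add: space_mu)
  also have "\<dots> = C * norm v"
    using covariant_isometry[of v] C0
    by (simp add: real_sqrt_mult L2chi_norm_def covariant_transform_def)
  finally have norm_u: "norm u \<le> C * norm v" using u(2) by simp
  have "has_weak_integral \<mu> (\<lambda>x. (k x * cinner \<phi> (\<rho> (s x) \<phi>)) *\<^sub>C \<rho> (s x) v) u"
    unfolding has_weak_integral_def
  proof
    fix w
    \<comment> \<open>Integrating over \<open>y\<close> first gives the integrand of the relative
      convolution, over \<open>x\<close> first that of the contravariant transform of
      \<open>F\<close>.\<close>
    define P where
      "P x y = k x * (cinner v (\<rho> (inv (s x) \<otimes> s y \<otimes> s x) \<phi>) * cinner (\<rho> (s y) \<phi>) w)" for x y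
    have P: "integrable (\<mu> \<Otimes>\<^sub>M \<mu>) (case_prod P)"
      using integrable_twisted[OF k] by (simp add: P_def[abs_def])
    have P_y: "(LINT y|\<mu>. P x y) = cinner ((k x * cinner \<phi> (\<rho> (s x) \<phi>)) *\<^sub>C \<rho> (s x) v) w"
      if "x \<in> space \<mu>" for x
      using that by (simp add: P_def reproducing_translate space_mu cinner_scaleC_left mult.assoc)
    have P_x: "(LINT x|\<mu>. P x y) = cinner (contravariant_integrand s \<rho> \<phi> F y) w"
      if "y \<in> space \<mu>" for y
    proof -
      have "(LINT x|\<mu>. P x y) =
          (LINT x|\<mu>. k x * cinner v (\<rho> (inv (s x) \<otimes> s y \<otimes> s x) \<phi>) * cinner (\<rho> (s y) \<phi>) w)"
        by (simp add: P_def mult.assoc)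
      also have "\<dots> = F (s y) * cinner (\<rho> (s y) \<phi>) w"
        using that by (simp add: F_eq space_mu)
      finally show ?thesis by (simp add: contravariant_integrand_def cinner_scaleC_left)
    qed
    \<comment> \<open>A weak integral requires integrability besides the value; Fubini supplies
      both.\<close>
    have "integrable \<mu> (\<lambda>x. LINT y|\<mu>. P x y)"
      using integrable_fst'[OF P] by simp
    then have "integrable \<mu> (\<lambda>x. cinner ((k x * cinner \<phi> (\<rho> (s x) \<phi>)) *\<^sub>C \<rho> (s x) v) w)"
      by (subst Bochner_Integration.integrable_cong[OF refl P_y, symmetric])
    moreover have "(LINT x|\<mu>. cinner ((k x * cinner \<phi> (\<rho> (s x) \<phi>)) *\<^sub>C \<rho> (s x) v) w) = cinner u w"
    proof -
      have "(LINT x|\<mu>. cinner ((k x * cinner \<phi> (\<rho> (s x) \<phi>)) *\<^sub>C \<rho> (s x) v) w) =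
          (LINT x|\<mu>. LINT y|\<mu>. P x y)"
        by (rule Bochner_Integration.integral_cong) (simp_all add: P_y)
      also have "\<dots> = (LINT y|\<mu>. LINT x|\<mu>. P x y)"
        by (rule Fubini_integral[OF P, symmetric])
      also have "\<dots> = (LINT y|\<mu>. cinner (contravariant_integrand s \<rho> \<phi> F y) w)"
        by (rule Bochner_Integration.integral_cong) (simp_all add: P_x)
      also have "\<dots> = cinner u w" using u(1) by (simp add: has_weak_integral_def)
      finally show ?thesis .
    qed
    ultimately show "integrable \<mu> (\<lambda>x. cinner ((k x * cinner \<phi> (\<rho> (s x) \<phi>)) *\<^sub>C \<rho> (s x) v) w) \<and>
        (LINT x|\<mu>. cinner ((k x * cinner \<phi> (\<rho> (s x) \<phi>)) *\<^sub>C \<rho> (s x) v) w) = cinner u w"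
      by blast
  qed
  with norm_u show ?thesis by blast
qed

end

text \<open>The first two conjuncts guarantee that the definite description in
  \<open>relative_convolution\<close> and the real supremum in \<open>onorm\<close> are meaningful.
  The right-hand supremum is taken in \<open>ereal\<close>, where it always exists.\<close>

theorem proposition5p8:
  fixes G :: "('g, 'm) monoid_scheme"
    and T :: "'g topology"
    and E :: "'e::euclidean_space set"
    and A :: "('g, 'e) chart set"
    and H :: "'g set"
    and s :: "'g set \<Rightarrow> 'g"
    and \<mu> :: "'g set measure"
    and chi :: "'g \<Rightarrow> complex"
    and \<rho> :: "'g \<Rightarrow> 'v::complex_hilbert \<Rightarrow> 'v"
    and \<phi> :: 'v
    and \<Phi> :: "'g \<Rightarrow> complex"
    and f :: "'g set \<Rightarrow> complex"
  assumes "exponential_lie_group G T E A"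
    and "subgroup H G" and "closedin T H"
    and "complemented_commutator G T H s"
    and "invariant_measure G T H \<mu>"
    and "unitary_character G T H chi"
    and "unitary_representation G T \<rho>"
    and "irreducible_representation G \<rho>"
    and "induced_representation G H s \<mu> chi \<rho>"
    and "admissible_vector G H s \<mu> chi \<rho> \<phi>"
    and "\<Phi> = covariant_transform \<rho> \<phi> \<phi>"
    and "\<forall>x\<in>lcosets\<^bsub>G\<^esub> H. \<Phi> (s x) \<noteq> 0"
    and "integrable \<mu> (\<lambda>x. f x * inverse (\<Phi> (s x)))"
  shows "(\<forall>v. has_weak_integral \<mu> (\<lambda>x. f x *\<^sub>C \<rho> (s x) v) (relative_convolution s \<mu> \<rho> f v)) \<and>
         bounded_linear (relative_convolution s \<mu> \<rho> f) \<and>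
         ereal (onorm (relative_convolution s \<mu> \<rho> f)) \<le>
           (SUP g\<in>carrier G.
              ereal (norm (frown G s \<mu> chi (\<lambda>x. f x * inverse (\<Phi> (s x))) g)))"
proof -
  have lie: "lie_group G T E A" using assms(1) by (simp add: exponential_lie_group_def)
  interpret group G using lie by (simp add: lie_group_def)
  interpret subgroup H G by fact
  interpret admissible_setting G H T s \<mu> chi \<rho> \<phi>
    using lie assms
    by unfold_locales
      (simp_all add: lie_group_def smooth_manifold_def smooth_map_def covariant_transform_def)
  define k where "k x = f x * inverse (\<Phi> (s x))" for x
  have k: "integrable \<mu> k" using assms(13) by (simp add: k_def[abs_def])
  define S where "S = (SUP g\<in>carrier G. ereal (norm (frown G s \<mu> chi k g)))"
  \<comment> \<open>The value at the identity and the bound by the \<open>L_1\<close> norm of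
    \<open>k\<close> confine \<open>S\<close> to the reals.\<close>
  have "ereal 0 \<le> ereal (norm (frown G s \<mu> chi k \<one>\<^bsub>G\<^esub>))" by simp
  also have "\<dots> \<le> S" unfolding S_def by (rule SUP_upper) simp
  finally have S0: "0 \<le> S" by (simp add: zero_ereal_def)
  have "S \<le> ereal (LINT x|\<mu>. norm (k x))"
    unfolding S_def by (rule SUP_least) (simp add: norm_frown_le)
  then obtain C where C: "S = ereal C" using S0 by (cases S) auto
  have C0: "0 \<le> C" using S0 C by simp
  have frown_le: "norm (frown G s \<mu> chi k g) \<le> C" if "g \<in> carrier G" for g
    using SUP_upper[of g "carrier G" "\<lambda>g. ereal (norm (frown G s \<mu> chi k g))"] that C
    by (simp add: S_def)
  let ?R = "relative_convolution s \<mu> \<rho> f"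
  have R: "has_weak_integral \<mu> (\<lambda>x. f x *\<^sub>C \<rho> (s x) v) (?R v) \<and> norm (?R v) \<le> C * norm v" for v
  proof -
    obtain u where u: "has_weak_integral \<mu> (\<lambda>x. (k x * cinner \<phi> (\<rho> (s x) \<phi>)) *\<^sub>C \<rho> (s x) v) u"
      "norm u \<le> C * norm v"
      using relative_convolution_eq_contravariant[OF k frown_le] by blast
    \<comment> \<open>Cancelling \<open>\<Phi> (s x)\<close> is justified on
      \<open>space \<mu>\<close>, which is enough for the weak integral.\<close>
    have "k x * cinner \<phi> (\<rho> (s x) \<phi>) = f x" if "x \<in> space \<mu>" for x
      using that nonvanishing[of x] assms(11)
      by (simp add: k_def covariant_transform_def space_mu field_simps)
    then have "has_weak_integral \<mu> (\<lambda>x. f x *\<^sub>C \<rho> (s x) v) u"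
      using u(1) by (subst has_weak_integral_cong[symmetric]) auto
    then show ?thesis
      using u(2) by (simp add: relative_convolution_def weak_integral_eqI)
  qed
  have linear: "bounded_linear ?R"
  proof (rule bounded_linear_intro)
    \<comment> \<open>Additivity and homogeneity follow from uniqueness: both sides are weak
      integrals of the same function.\<close>
    fix u v
    have "has_weak_integral \<mu> (\<lambda>x. f x *\<^sub>C \<rho> (s x) u + f x *\<^sub>C \<rho> (s x) v) (?R u + ?R v)"
      using R by (intro has_weak_integral_add) auto
    then have "has_weak_integral \<mu> (\<lambda>x. f x *\<^sub>C \<rho> (s x) (u + v)) (?R u + ?R v)"
      by (rule has_weak_integral_cong[THEN iffD1, rotated])
         (simp add: rho_add scaleC_add_right s_closed space_mu)
    then show "?R (u + v) = ?R u + ?R v"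
      using R has_weak_integral_unique by blast
  next
    \<comment> \<open>The real scalar is treated as a complex one, for which \<open>\<rho>\<close>
      is known to be homogeneous.\<close>
    fix r v
    have "has_weak_integral \<mu> (\<lambda>x. complex_of_real r *\<^sub>C f x *\<^sub>C \<rho> (s x) v)
        (complex_of_real r *\<^sub>C ?R v)"
      using R by (intro has_weak_integral_scaleC) auto
    then have "has_weak_integral \<mu> (\<lambda>x. f x *\<^sub>C \<rho> (s x) (complex_of_real r *\<^sub>C v))
        (complex_of_real r *\<^sub>C ?R v)"
      by (rule has_weak_integral_cong[THEN iffD1, rotated])
         (simp add: rho_scaleC scaleC_scaleC s_closed space_mu mult.commute)
    then show "?R (r *\<^sub>R v) = r *\<^sub>R ?R v"
      using R has_weak_integral_unique by (metis scaleC_of_real)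
  next
    show "norm (?R v) \<le> norm v * C" for v
      using R[of v] by (simp add: mult.commute)
  qed
  have "onorm ?R \<le> C" by (rule onorm_bound) (use C0 R in auto)
  then have "ereal (onorm ?R) \<le> S" by (simp add: C)
  then show ?thesis using R linear unfolding S_def k_def[abs_def] by blast
qed

end
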